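(* There exists a $[7,3]_2$ MWS code, and there exists a $[32,3]_3$ MWS code.
   Context: An $[n,k]_q$ code is a $k$-dimensional subspace of $\mathbb{F}_q^n$, non-degenerate (no coordinate identically zero on the code). It is a maximum weight spectrum (MWS) code if the set of its non-zero Hamming weights has cardinality $\frac{q^k-1}{q-1}$ (so $7$ for $q=2,k=3$ and $13$ for $q=3,k=3$). *)

theory Defs
  imports "HOL-Analysis.Analysis"
begin

text \<open>Vectors of length n over a field 'a are modelled as 'a^'n, with CARD('n) = n.
  The field F_q is modelled by an arbitrary finite field type 'a with CARD('a) = q.\<close>

definition hamming_wt :: "('a::zero)^('n::finite) \<Rightarrow> nat" where
  "hamming_wt x = card {i. x $ i \<noteq> 0}"

text \<open>An [n,k]_q code: a k-dimensional subspace of F_q^n, non-degenerate.\<close>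
definition is_code :: "nat \<Rightarrow> (('a::{field,finite})^('n::finite)) set \<Rightarrow> bool" where
  "is_code k C \<longleftrightarrow> vec.subspace C \<and> vec.dim C = k \<and> (\<forall>i. \<exists>c\<in>C. c $ i \<noteq> 0)"

text \<open>Maximum weight spectrum: number of distinct nonzero weights equals (q^k-1)/(q-1).\<close>
definition is_MWS_code :: "nat \<Rightarrow> (('a::{field,finite})^('n::finite)) set \<Rightarrow> bool" where
  "is_MWS_code k C \<longleftrightarrow> is_code k C \<and>
     card (hamming_wt ` (C - {0})) = (CARD('a) ^ k - 1) div (CARD('a) - 1)"

end

(* A field of prime cardinality p is the image of the residues 0..p-1 under of_int. So a code
   over it can be given by a generator matrix with integer columns c_1, ..., c_n: its codewords
   are the vectors (t . c_i)_i for residue triples t, and the weight of such a codeword is the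
   number of columns c with p not dividing t . c. Once the columns are fixed, dimension 3,
   non-degeneracy and the number of distinct weights are all decided by a finite computation
   over integers, which is carried out for an explicit [7,3]_2 and [32,3]_3 generator matrix. *)

theory Submission
  imports Defs "HOL-Number_Theory.Residues"
begin

lemma CHAR_eq_CARD_if_prime:
  assumes "prime CARD('a::{field,finite})"
  shows "CHAR('a) = CARD('a)"
  using CHAR_dvd_CARD[where 'a='a] CHAR_not_1[where 'a='a] assms
  by (metis One_nat_def prime_nat_iff)

lemma of_int_eq_0_iff_CARD_dvd:
  assumes "prime CARD('a::{field,finite})"
  shows "(of_int m = (0::'a)) \<longleftrightarrow> int CARD('a) dvd m"
  using of_int_eq_0_iff_char_dvd CHAR_eq_CARD_if_prime[OF assms] by metis

lemma of_int_residues_eq_UNIV: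
  assumes "prime CARD('a::{field,finite})"
  shows "(of_int ` {0..<int CARD('a)} :: 'a set) = UNIV"
proof -
  let ?p = "int CARD('a)"
  have "inj_on (of_int :: int \<Rightarrow> 'a) {0..<?p}"
  proof (rule inj_onI)
    fix x y assume x: "x \<in> {0..<?p}" and y: "y \<in> {0..<?p}" and "(of_int x :: 'a) = of_int y"
    then have "?p dvd x - y"
      using of_int_eq_0_iff_CARD_dvd[OF assms, of "x - y"] by simp
    with x y show "x = y"
      by (metis atLeastLessThan_iff mod_eq_dvd_iff mod_pos_pos_trivial)
  qed
  then have "card (of_int ` {0..<?p} :: 'a set) = CARD('a)"
    by (simp add: card_image)
  then show ?thesis
    by (simp add: card_eq_UNIV_imp_eq_UNIV)
qed

lemma of_int_residue_eq_0_iff: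
  assumes "prime CARD('a::{field,finite})" and "x \<in> {0..<int CARD('a)}"
  shows "(of_int x = (0::'a)) \<longleftrightarrow> x = 0"
  using assms of_int_eq_0_iff_CARD_dvd[OF assms(1), of x]
  by (metis atLeastLessThan_iff dvd_imp_mod_0 mod_pos_pos_trivial of_int_0)

lemma is_code_range_matrix_vector_mult:
  fixes A :: "'a::{field,finite}^'k^'n"
  assumes inj: "inj ((*v) A)" and nonzero_rows: "\<forall>i. A $ i \<noteq> 0"
  shows "is_code CARD('k) (range ((*v) A))"
  unfolding is_code_def
proof (intro conjI allI)
  show "vec.subspace (range ((*v) A))"
    by (rule vec.subspace_image[OF vec.subspace_UNIV])
  show "vec.dim (range ((*v) A)) = CARD('k)"
    using vec.dim_image_eq[OF matrix_vector_mul_linear_gen, of A UNIV] inj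
    by (simp add: card_cart_basis)
  fix i
  obtain j where "A $ i $ j \<noteq> 0"
    using nonzero_rows by (auto simp: vec_eq_iff)
  moreover have "(A *v axis j 1) $ i = A $ i $ j"
    by (simp add: matrix_vector_mult_def axis_def if_distrib cong: if_cong)
  ultimately show "\<exists>c\<in>range ((*v) A). c $ i \<noteq> 0"
    by (metis rangeI)
qed

definition dot3 :: "int \<times> int \<times> int \<Rightarrow> int \<times> int \<times> int \<Rightarrow> int" where
  "dot3 = (\<lambda>(a, b, c) (x, y, z). a * x + b * y + c * z)"

definition vec3_of_int :: "int \<times> int \<times> int \<Rightarrow> 'a::ring_1^3" where
  "vec3_of_int = (\<lambda>(a, b, c). vector [of_int a, of_int b, of_int c])"

definition residues3 :: "int \<Rightarrow> (int \<times> int \<times> int) set" where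
  "residues3 p = {0..<p} \<times> {0..<p} \<times> {0..<p}"

lemma matrix_vector_mult_vec3_of_int:
  "(\<chi> i. vec3_of_int (col i)) *v vec3_of_int t = (\<chi> i. of_int (dot3 (col i) t) :: 'a::comm_ring_1^'n)"
  by (cases t) (auto simp: vec_eq_iff matrix_vector_mult_def sum_3 vec3_of_int_def dot3_def
      split: prod.splits)

lemma hamming_wt_of_int:
  assumes "prime CARD('a::{field,finite})"
  shows "hamming_wt (\<chi> i. of_int (f i) :: 'a^'n) = card {i. \<not> int CARD('a) dvd f i}"
  by (simp add: hamming_wt_def of_int_eq_0_iff_CARD_dvd[OF assms])

lemma vec3_of_int_residues3:
  assumes prime: "prime CARD('a::{field,finite})"
  shows "vec3_of_int ` (residues3 (int CARD('a)) - {(0, 0, 0)}) = UNIV - {0 :: 'a^3}"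
proof
  let ?R = "{0..<int CARD('a)}"
  have "t = (0, 0, 0)" if "t \<in> residues3 (int CARD('a))" and "vec3_of_int t = (0 :: 'a^3)" for t
  proof (cases t)
    case (fields a b c)
    with that have "a \<in> ?R" "b \<in> ?R" "c \<in> ?R"
      and "of_int a = (0::'a)" "of_int b = (0::'a)" "of_int c = (0::'a)"
      by (simp_all add: residues3_def vec3_of_int_def vec_eq_iff forall_3)
    then have "a = 0" "b = 0" "c = 0"
      using of_int_residue_eq_0_iff[OF prime] by simp_all
    with fields show ?thesis by simp
  qed
  then show "vec3_of_int ` (residues3 (int CARD('a)) - {(0, 0, 0)}) \<subseteq> UNIV - {0 :: 'a^3}"
    by auto
  show "UNIV - {0 :: 'a^3} \<subseteq> vec3_of_int ` (residues3 (int CARD('a)) - {(0, 0, 0)})"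
  proof
    fix x :: "'a^3" assume "x \<in> UNIV - {0}"
    have "y \<in> of_int ` ?R" for y :: 'a
      using of_int_residues_eq_UNIV[OF prime] by simp
    then obtain a b c where "a \<in> ?R" "b \<in> ?R" "c \<in> ?R"
      and "x $ 1 = of_int a" "x $ 2 = of_int b" "x $ 3 = of_int c"
      by (meson imageE)
    then have abc: "(a, b, c) \<in> residues3 (int CARD('a))"
      and "x = vec3_of_int (a, b, c)"
      by (simp_all add: residues3_def vec3_of_int_def vec_eq_iff forall_3)
    moreover have "vec3_of_int (0, 0, 0) = (0 :: 'a^3)"
      by (simp add: vec3_of_int_def vec_eq_iff forall_3)
    ultimately show "x \<in> vec3_of_int ` (residues3 (int CARD('a)) - {(0, 0, 0)})"
      using abc \<open>x \<in> UNIV - {0}\<close> by blast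
  qed
qed

lemma code_of_int_columns:
  fixes col :: "'n::finite \<Rightarrow> int \<times> int \<times> int"
  assumes prime: "prime CARD('a::{field,finite})"
    and nonzero_columns: "\<And>i. \<exists>t\<in>residues3 (int CARD('a)). \<not> int CARD('a) dvd dot3 (col i) t"
    and nonzero_codewords: "\<And>t. t \<in> residues3 (int CARD('a)) - {(0, 0, 0)} \<Longrightarrow>
      \<exists>i. \<not> int CARD('a) dvd dot3 (col i) t"
  shows "is_code 3 (range ((*v) ((\<chi> i. vec3_of_int (col i)) :: 'a^3^'n)))"
    and "hamming_wt ` (range ((*v) ((\<chi> i. vec3_of_int (col i)) :: 'a^3^'n)) - {0}) =
      (\<lambda>t. card {i. \<not> int CARD('a) dvd dot3 (col i) t}) ` (residues3 (int CARD('a)) - {(0, 0, 0)})"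
proof -
  let ?p = "int CARD('a)" and ?R0 = "residues3 (int CARD('a)) - {(0, 0, 0)}"
  define A :: "'a^3^'n" where "A = (\<chi> i. vec3_of_int (col i))"
  have weight: "hamming_wt (A *v vec3_of_int t) = card {i. \<not> ?p dvd dot3 (col i) t}" for t
    by (simp add: A_def matrix_vector_mult_vec3_of_int hamming_wt_of_int[OF prime])
  have messages: "vec3_of_int ` ?R0 = UNIV - {0 :: 'a^3}"
    by (rule vec3_of_int_residues3[OF prime])
  have "A *v x \<noteq> 0" if "x \<noteq> 0" for x
  proof
    have "x \<in> vec3_of_int ` ?R0"
      using messages \<open>x \<noteq> 0\<close> by simp
    then obtain t where t: "t \<in> ?R0" "x = vec3_of_int t"
      by (rule imageE)
    assume "A *v x = 0"
    then have "card {i. \<not> ?p dvd dot3 (col i) t} = 0"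
      using weight[of t] t by (simp add: hamming_wt_def)
    then show False
      using nonzero_codewords[OF t(1)] by simp
  qed
  then have inj: "inj ((*v) A)"
    by (auto simp: vec.linear_inj_iff_eq_0[OF matrix_vector_mul_linear_gen])
  have "A $ i \<noteq> 0" for i
  proof
    obtain t where "\<not> ?p dvd dot3 (col i) t"
      using nonzero_columns by blast
    then have "(A *v vec3_of_int t) $ i \<noteq> 0"
      by (simp add: A_def matrix_vector_mult_vec3_of_int of_int_eq_0_iff_CARD_dvd[OF prime])
    moreover assume "A $ i = 0"
    ultimately show False
      by (simp add: matrix_vector_mult_def)
  qed
  then show "is_code 3 (range ((*v) ((\<chi> i. vec3_of_int (col i)) :: 'a^3^'n)))"
    using is_code_range_matrix_vector_mult[OF inj] by (simp add: A_def)
  have "range ((*v) A) - {0} = (*v) A ` (vec3_of_int ` ?R0)"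
    unfolding messages using inj by (simp add: image_set_diff)
  then show "hamming_wt ` (range ((*v) ((\<chi> i. vec3_of_int (col i)) :: 'a^3^'n)) - {0}) =
      (\<lambda>t. card {i. \<not> ?p dvd dot3 (col i) t}) ` ?R0"
    by (simp add: A_def[symmetric] image_image weight)
qed

lemma obtain_enumeration:
  assumes "CARD('n) = length xs"
  obtains f :: "'n::finite \<Rightarrow> 'b" where "\<And>P. card {i. P (f i)} = length (filter P xs)"
proof -
  let ?I = "{0..<length xs}"
  obtain h where h: "bij_betw h ?I (UNIV :: 'n set)"
    using ex_bij_betw_nat_finite[of "UNIV :: 'n set"] assms by auto
  define f where "f i = xs ! inv_into ?I h i" for i
  have "{i. P (f i)} = h ` {k. k < length xs \<and> P (xs ! k)}" for P
  proof (rule Set.set_eqI)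
    fix i
    have "inv_into ?I h i \<in> ?I" and "h (inv_into ?I h i) = i"
      using bij_betwE[OF bij_betw_inv_into[OF h]] bij_betw_inv_into_right[OF h] by auto
    then show "i \<in> {i. P (f i)} \<longleftrightarrow> i \<in> h ` {k. k < length xs \<and> P (xs ! k)}"
      using bij_betw_inv_into_left[OF h] by (force simp: f_def)
  qed
  moreover have "inj_on h {k. k < length xs \<and> P (xs ! k)}" for P
    by (rule inj_on_subset[OF bij_betw_imp_inj_on[OF h]]) auto
  ultimately have "card {i. P (f i)} = length (filter P xs)" for P
    by (simp add: card_image length_filter_conv_card)
  then show thesis
    by (rule that)
qed

definition codeword_weight :: "int \<Rightarrow> (int \<times> int \<times> int) list \<Rightarrow> int \<times> int \<times> int \<Rightarrow> nat" where
  "codeword_weight p cols t = length (filter (\<lambda>c. \<not> p dvd dot3 c t) cols)"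

lemma exists_MWS_code_of_int_columns:
  fixes cols :: "(int \<times> int \<times> int) list"
  assumes prime: "prime CARD('a::{field,finite})" and length: "CARD('n::finite) = length cols"
    and p: "int CARD('a) = p"
    and nonzero_columns: "\<forall>c\<in>set cols. \<exists>t\<in>residues3 p. \<not> p dvd dot3 c t"
    and nonzero_codewords: "\<forall>t\<in>residues3 p - {(0, 0, 0)}. 0 < codeword_weight p cols t"
    and weights: "card (codeword_weight p cols ` (residues3 p - {(0, 0, 0)})) =
      (CARD('a) ^ 3 - 1) div (CARD('a) - 1)"
  shows "\<exists>C :: ('a^'n) set. is_MWS_code 3 C"
proof -
  obtain col :: "'n \<Rightarrow> int \<times> int \<times> int" where count: "\<And>P. card {i. P (col i)} = length (filter P cols)"
    using obtain_enumeration[OF length] by blast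
  have ex_col: "(\<exists>i. P (col i)) \<longleftrightarrow> (\<exists>c\<in>set cols. P c)" for P
    using count[of P] by (metis (mono_tags) card_gt_0_iff empty_Collect_eq finite
        filter_empty_conv length_greater_0_conv)
  have weight: "card {i. \<not> p dvd dot3 (col i) t} = codeword_weight p cols t" for t
    using count[of "\<lambda>c. \<not> p dvd dot3 c t"] by (simp add: codeword_weight_def)
  have codewords: "\<exists>i. \<not> p dvd dot3 (col i) t" if "t \<in> residues3 p - {(0, 0, 0)}" for t
    using nonzero_codewords that ex_col[of "\<lambda>c. \<not> p dvd dot3 c t"]
    by (simp add: codeword_weight_def length_greater_0_conv filter_empty_conv)
  have columns: "\<exists>t\<in>residues3 p. \<not> p dvd dot3 (col i) t" for i
    using nonzero_columns ex_col[of "\<lambda>c. c = col i"] by blast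
  let ?C = "range ((*v) ((\<chi> i. vec3_of_int (col i)) :: 'a^3^'n))"
  have "is_code 3 ?C" and "hamming_wt ` (?C - {0}) = codeword_weight p cols ` (residues3 p - {(0, 0, 0)})"
    using code_of_int_columns[OF prime, of col, unfolded p, OF columns codewords]
    by (simp_all add: weight)
  with weights show ?thesis
    unfolding is_MWS_code_def by (intro exI[of _ ?C]) simp
qed

(* The message (a, b, c) gets weight a + 2b + 4c, so the seven weights 1, ..., 7 all occur. *)
definition columns_GF2 :: "(int \<times> int \<times> int) list" where
  "columns_GF2 = replicate 4 (0, 0, 1) @ replicate 2 (0, 1, 0) @ [(1, 0, 0)]"

definition columns_GF3 :: "(int \<times> int \<times> int) list" where
  "columns_GF3 = replicate 2 (0, 0, 1) @ [(0, 1, 1)] @ replicate 4 (1, 0, 0) @ replicate 3 (1, 1, 1)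
    @ replicate 7 (1, 1, 2) @ [(1, 2, 0)] @ replicate 7 (1, 2, 1) @ replicate 7 (1, 2, 2)"

theorem mainTheorem13:
  assumes "CARD('a::{field,finite}) = 2" and "CARD('b::{field,finite}) = 3"
  shows "(\<exists>C :: ('a^7) set. is_MWS_code 3 C) \<and> (\<exists>D :: ('b^32) set. is_MWS_code 3 D)"
proof
  have "\<forall>c\<in>set columns_GF2. \<exists>t\<in>residues3 2. \<not> 2 dvd dot3 c t"
    and "\<forall>t\<in>residues3 2 - {(0, 0, 0)}. 0 < codeword_weight 2 columns_GF2 t"
    and "card (codeword_weight 2 columns_GF2 ` (residues3 2 - {(0, 0, 0)})) = 7"
    by code_simp+
  with assms(1) show "\<exists>C :: ('a^7) set. is_MWS_code 3 C"
    by (intro exists_MWS_code_of_int_columns[where p = 2]) (simp_all add: columns_GF2_def)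
next
  have "\<forall>c\<in>set columns_GF3. \<exists>t\<in>residues3 3. \<not> 3 dvd dot3 c t"
    and "\<forall>t\<in>residues3 3 - {(0, 0, 0)}. 0 < codeword_weight 3 columns_GF3 t"
    and "card (codeword_weight 3 columns_GF3 ` (residues3 3 - {(0, 0, 0)})) = 13"
    by code_simp+
  with assms(2) show "\<exists>D :: ('b^32) set. is_MWS_code 3 D"
    by (intro exists_MWS_code_of_int_columns[where p = 3]) (simp_all add: columns_GF3_def)
qed

end
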